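(* Let $0<\beta<1$, $-\beta<\theta<\beta$, $k\in\mathbb{N}$ ($k\ge1$) and $t>0$. For $\gamma>0$ let $X_j^{\gamma,2\beta k}$ and $Y_j^{\gamma,2\beta k}$, $j\ge0$, be i.i.d. random variables with distribution $\Pr\{X^{\gamma,2\beta k}>w\}=(\gamma/w)^{2\beta k}$ for $w>\gamma$ and $=1$ for $w<\gamma$. Let $U^{2k}$ be a pseudoprocess of order $2k$, let $U_j^{2k}(1)$ denote independent pseudo random variables with the law of $U^{2k}(1)$, and let $N$ denote a homogeneous Poisson process with parameter $\lambda=1/\Gamma(1-\beta)$, all independent of each other and of the $X_j^{\gamma,2\beta k}$, $Y_j^{\gamma,2\beta k}$. The two random sums below are independent pseudo random walks (the first and second sum use independent copies of the Poisson process and of the pseudo random variables). Then $$\lim_{\gamma\to0}\left[\left(\frac{\sin\frac{\pi}{2}(\beta-\theta)}{\sin\pi\beta}\right)^{\frac{1}{2\beta k}}\sum_{j=0}^{N(t\gamma^{-2\beta k})}X_j^{\gamma,2\beta k}U_j^{2k}(1)+\left(\frac{\sin\frac{\pi}{2}(\beta+\theta)}{\sin\pi\beta}\right)^{\frac{1}{2\beta k}}\sum_{j=0}^{N(t\gamma^{-2\beta k})}Y_j^{\gamma,2\beta k}U_j^{2k}(1)\right]\stackrel{\text{law}}{=}Z^{2k\beta,\theta}(t),$$ where the signed law of $Z^{2k\beta,\theta}(t)$ has Fourier transform $$\mathbb{E}e^{i\xi Z^{2k\beta,\theta}(t)}=\exp\left\{-t|\xi|^{2k\beta}\,\frac{\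cos\frac{\pi}{2}\theta}{\cos\frac{\pi}{2}\beta}\right\},\qquad\xi\in\mathbb{R}.$$
   Context: Pseudo random variables and pseudoprocesses have signed laws of total mass one, and expectations $\mathbb{E}e^{i\xi\,\cdot}$ are understood with respect to these signed laws through Fourier transforms. The pseudoprocess $U^{2k}$ has at time $s$ the signed density $u_{2k}(x,s)$, the fundamental solution of $\partial_s u=(-1)^{k+1}\partial_x^{2k}u$, i.e. $\int_{\mathbb{R}}e^{i\xi x}u_{2k}(x,s)\,dx=e^{-s|\xi|^{2k}}$. Independence of pseudo random variables means that the Fourier transform of the law of a sum is the product of the Fourier transforms. For a genuine random variable $X$ independent of $U^{2k}(1)$, $\mathbb{E}e^{i\xi U^{2k}(1)X}=\mathbb{E}\big[e^{-|\xi X|^{2k}}\big]$; the Fourier transform of a random sum is likewise computed by conditioning on the genuine random variables. The limit in law means pointwise convergence of Fourier transforms for every $\xi\in\mathbb{R}$. *)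

theory Defs
  imports "HOL-Probability.Probability"
begin

section \<open>Signed laws and pseudo random variables\<close>

text \<open>A signed law on the real line is given by its density with respect to Lebesgue
  measure; \<open>iexp x\<close> is the library's notation for \<open>exp (\<i> * x)\<close>.\<close>

definition signed_ft :: "(real \<Rightarrow> real) \<Rightarrow> real \<Rightarrow> complex" where
  "signed_ft p \<xi> = (\<integral>x. iexp (\<xi> * x) * complex_of_real (p x) \<partial>lborel)"

text \<open>\<open>u x s\<close> is the signed density at time \<open>s\<close> of the pseudoprocess of order \<open>2 * k\<close>: the
  fundamental solution of \<open>\<partial>u/\<partial>s = (- 1) ^ (k + 1) * \<partial>\<^sup>2\<^sup>ku/\<partial>x\<^sup>2\<^sup>k\<close>. Under the Fourier
  transform in \<open>x\<close> this Cauchy problem becomes \<open>dv/ds = - \<bar>\<xi>\<bar> ^ (2 * k) * v\<close> with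
  \<open>v = 1\<close> at \<open>s = 0\<close>; the transform fixes \<open>u\<close> up to Lebesgue null sets in \<open>x\<close>,
  that is, it fixes the signed law. The value at \<open>\<xi> = 0\<close> says that the total mass is one.\<close>

definition pseudoprocess_density :: "nat \<Rightarrow> (real \<Rightarrow> real \<Rightarrow> real) \<Rightarrow> bool" where
  "pseudoprocess_density k u \<longleftrightarrow>
     (\<forall>s>0. integrable lborel (\<lambda>x. u x s) \<and>
       (\<forall>\<xi>. signed_ft (\<lambda>x. u x s) \<xi> = complex_of_real (exp (- s * \<bar>\<xi>\<bar> ^ (2 * k)))))"

text \<open>Fourier transform of the law of a functional \<open>S\<close> of the genuine outcome \<open>\<omega>\<close> and of
  pseudo random variables \<open>y i\<close>, \<open>i \<in> I \<omega>\<close>, computed by conditioning on \<open>\<omega>\<close>. The \<open>y i\<close> are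
  independent of each other and of the genuine randomness and all have signed density \<open>p\<close>:
  given \<open>\<omega>\<close>, their joint signed law has density \<open>\<Prod>i\<in>I \<omega>. p (y i)\<close>. The index set may
  depend on \<open>\<omega>\<close>, since a random sum involves a random number of them.\<close>

definition pseudo_ft ::
  "'a measure \<Rightarrow> (real \<Rightarrow> real) \<Rightarrow> ('a \<Rightarrow> 'i set) \<Rightarrow> ('a \<Rightarrow> ('i \<Rightarrow> real) \<Rightarrow> real) \<Rightarrow> real \<Rightarrow> complex"
where
  "pseudo_ft M p I S \<xi> =
     (\<integral>\<omega>. (\<integral>y. iexp (\<xi> * S \<omega> y) * complex_of_real (\<Prod>i\<in>I \<omega>. p (y i))
            \<partial>PiM (I \<omega>) (\<lambda>_. lborel)) \<partial>M)"

text \<open>The joint law above makes Fourier transforms of sums factorise, which is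
  what independence of pseudo random variables means.\<close>

lemma signed_ft_independent_sum:
  assumes "finite I" "integrable lborel p"
  shows "(\<integral>y. iexp (\<Sum>i\<in>I. a i * y i) * complex_of_real (\<Prod>i\<in>I. p (y i)) \<partial>PiM I (\<lambda>_. lborel))
         = (\<Prod>i\<in>I. signed_ft p (a i))"
proof -
  interpret product_sigma_finite "\<lambda>_. lborel :: real measure"
    by unfold_locales
  have int: "integrable lborel (\<lambda>x. iexp (b * x) * complex_of_real (p x))" for b
    by (rule Bochner_Integration.integrable_bound[OF assms(2)])
       (use assms(2) in \<open>auto simp: norm_mult\<close>)
  have "(\<integral>y. iexp (\<Sum>i\<in>I. a i * y i) * complex_of_real (\<Prod>i\<in>I. p (y i)) \<partial>PiM I (\<lambda>_. lborel))
      = (\<integral>y. (\<Prod>i\<in>I. iexp (a i * y i) * complex_of_real (p (y i))) \<partial>PiM I (\<lambda>_. lborel))"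
    using assms(1) by (simp add: prod.distrib exp_sum sum_distrib_left)
  also have "\<dots> = (\<Prod>i\<in>I. signed_ft p (a i))"
    unfolding signed_ft_def by (rule product_integral_prod[OF assms(1) int])
  finally show ?thesis .
qed

text \<open>\<open>\<Phi> \<gamma>\<close> is the Fourier transform of the law at parameter \<open>\<gamma>\<close>, and \<open>\<phi>\<close> that of the limit law.\<close>

definition limit_in_law_0 :: "(real \<Rightarrow> real \<Rightarrow> complex) \<Rightarrow> (real \<Rightarrow> complex) \<Rightarrow> bool" where
  "limit_in_law_0 \<Phi> \<phi> \<longleftrightarrow> (\<forall>\<xi>. ((\<lambda>\<gamma>. \<Phi> \<gamma> \<xi>) \<longlongrightarrow> \<phi> \<xi>) (at_right 0))"


section \<open>Genuine randomness\<close>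

definition power_tail :: "'a measure \<Rightarrow> real \<Rightarrow> real \<Rightarrow> ('a \<Rightarrow> real) \<Rightarrow> bool" where
  "power_tail M \<gamma> \<alpha> X \<longleftrightarrow>
     X \<in> borel_measurable M \<and>
     (\<forall>w>\<gamma>. measure M {\<omega> \<in> space M. X \<omega> > w} = (\<gamma> / w) powr \<alpha>) \<and>
     (\<forall>w<\<gamma>. measure M {\<omega> \<in> space M. X \<omega> > w} = 1)"

text \<open>Natural number subtraction in the increments is harmless, because almost all
  paths are nondecreasing.\<close>

definition poisson_process :: "'a measure \<Rightarrow> real \<Rightarrow> (real \<Rightarrow> 'a \<Rightarrow> nat) \<Rightarrow> bool" where
  "poisson_process M rate N \<longleftrightarrow>
     (\<forall>s\<ge>0. N s \<in> measurable M (count_space UNIV)) \<and>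
     (AE \<omega> in M. N 0 \<omega> = 0 \<and> mono_on {0..} (\<lambda>s. N s \<omega>) \<and>
        (\<forall>s\<ge>0. continuous (at_right s) (\<lambda>r. N r \<omega>))) \<and>
     (\<forall>s r. 0 \<le> s \<longrightarrow> s < r \<longrightarrow>
        distr M (count_space UNIV) (\<lambda>\<omega>. N r \<omega> - N s \<omega>) =
        measure_pmf (poisson_pmf (rate * (r - s)))) \<and>
     (\<forall>(n::nat) \<tau>. 0 \<le> \<tau> 0 \<longrightarrow> strict_mono_on {..n} \<tau> \<longrightarrow>
        prob_space.indep_vars M (\<lambda>_. count_space UNIV)
          (\<lambda>i \<omega>. N (\<tau> (Suc i)) \<omega> - N (\<tau> i) \<omega>) {..<n})"

definition rv_events :: "'a measure \<Rightarrow> ('a \<Rightarrow> real) \<Rightarrow> 'a set set" where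
  "rv_events M X = {X -` A \<inter> space M | A. A \<in> sets borel}"

definition process_events :: "'a measure \<Rightarrow> (real \<Rightarrow> 'a \<Rightarrow> nat) \<Rightarrow> 'a set set" where
  "process_events M N = sigma_sets (space M) {N s -` A \<inter> space M | s A. 0 \<le> s}"

datatype source = StepX nat | StepY nat | ClockX | ClockY

fun source_events ::
  "'a measure \<Rightarrow> (nat \<Rightarrow> 'a \<Rightarrow> real) \<Rightarrow> (nat \<Rightarrow> 'a \<Rightarrow> real) \<Rightarrow> (real \<Rightarrow> 'a \<Rightarrow> nat) \<Rightarrow>
   (real \<Rightarrow> 'a \<Rightarrow> nat) \<Rightarrow> source \<Rightarrow> 'a set set"
where
  "source_events M X Y N N' (StepX j) = rv_events M (X j)"
| "source_events M X Y N N' (StepY j) = rv_events M (Y j)"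
| "source_events M X Y N N' ClockX = process_events M N"
| "source_events M X Y N N' ClockY = process_events M N'"

text \<open>The family on the left of \<open>indep_sets\<close> ranges over all sources at once, so this is mutual
  independence of all the \<open>X j\<close>, all the \<open>Y j\<close> and the two Poisson processes (as processes).\<close>

definition mutually_independent ::
  "'a measure \<Rightarrow> (nat \<Rightarrow> 'a \<Rightarrow> real) \<Rightarrow> (nat \<Rightarrow> 'a \<Rightarrow> real) \<Rightarrow> (real \<Rightarrow> 'a \<Rightarrow> nat) \<Rightarrow>
   (real \<Rightarrow> 'a \<Rightarrow> nat) \<Rightarrow> bool"
where
  "mutually_independent M X Y N N' \<longleftrightarrow>
     prob_space.indep_sets M (source_events M X Y N N') UNIV"


section \<open>The pair of pseudo random walks\<close>

text \<open>The weighted sum of the two walks at clock time \<open>\<tau>\<close>. The pseudo random variables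
  \<open>y (Inl j)\<close> drive the first walk and \<open>y (Inr j)\<close> the second, so that the two walks use
  independent copies; \<open>walks_index\<close> collects the ones that occur.\<close>

definition walks_index ::
  "(real \<Rightarrow> 'a \<Rightarrow> nat) \<Rightarrow> (real \<Rightarrow> 'a \<Rightarrow> nat) \<Rightarrow> real \<Rightarrow> 'a \<Rightarrow> (nat + nat) set" where
  "walks_index N N' \<tau> \<omega> = {..N \<tau> \<omega>} <+> {..N' \<tau> \<omega>}"

definition walks_sum ::
  "real \<Rightarrow> real \<Rightarrow> (nat \<Rightarrow> 'a \<Rightarrow> real) \<Rightarrow> (nat \<Rightarrow> 'a \<Rightarrow> real) \<Rightarrow> (real \<Rightarrow> 'a \<Rightarrow> nat) \<Rightarrow>
   (real \<Rightarrow> 'a \<Rightarrow> nat) \<Rightarrow> real \<Rightarrow> 'a \<Rightarrow> (nat + nat \<Rightarrow> real) \<Rightarrow> real"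
where
  "walks_sum a b X Y N N' \<tau> \<omega> y =
     a * (\<Sum>j=0..N \<tau> \<omega>. X j \<omega> * y (Inl j)) + b * (\<Sum>j=0..N' \<tau> \<omega>. Y j \<omega> * y (Inr j))"

end

theory Submission
  imports Defs
begin

text \<open>Conditioning on the genuine randomness turns each pseudo variable into a factor
  \<open>exp (- c * \<bar>X\<bar> ^ (2 * k))\<close>, so a walk with \<open>N \<tau> + 1\<close> steps contributes
  \<open>m * exp (- \<lambda> * \<tau> * (1 - m))\<close>, where \<open>m\<close> is the expectation of one factor. By the layer-cake
  formula, \<open>\<gamma> powr (- \<alpha>) * (1 - m)\<close> with \<open>\<alpha> = 2 * \<beta> * k\<close> is the integral of
  \<open>exp (- y) * min (\<gamma> powr (- \<alpha>)) ((y / c) powr (- \<beta>))\<close> over \<open>y > 0\<close>; by dominated convergence it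
  tends to \<open>c powr \<beta> * Gamma (1 - \<beta>)\<close>, and the rate \<open>1 / Gamma (1 - \<beta>)\<close> cancels the constant.
  The two limiting exponents add up by the sum formula for sines.\<close>

section \<open>The layer-cake formula for \<open>1 - exp (- Y)\<close>\<close>

lemma nn_integral_exp_upto:
  fixes v :: real
  assumes "0 \<le> v"
  shows "(\<integral>\<^sup>+y. ennreal (indicator {0<..} y * exp (- y)) * indicator {..<v} y \<partial>lborel) = ennreal (1 - exp (- v))"
proof -
  \<comment> \<open>The open interval is closed up at the cost of its two endpoints, a null set, so
    that the fundamental theorem of calculus on \<open>{0..v}\<close> applies.\<close>
  have "(\<integral>\<^sup>+y. ennreal (indicator {0<..} y * exp (- y)) * indicator {..<v} y \<partial>lborel)
      = (\<integral>\<^sup>+y. ennreal (exp (- y)) * indicator {0..v} y \<partial>lborel)"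
    by (rule nn_integral_cong_AE)
       (use AE_lborel_singleton[of 0] AE_lborel_singleton[of v] in eventually_elim, auto simp: indicator_def)
  also have "\<dots> = ennreal (- exp (- v) - (- exp (- 0)))"
    by (rule nn_integral_FTC_Icc[where F = "\<lambda>y. - exp (- y)"])
       (use assms in \<open>auto intro!: derivative_eq_intros\<close>)
  finally show ?thesis by simp
qed

text \<open>\<open>1 - exp (- Y)\<close> is the mass that the standard exponential density puts
  below \<open>Y\<close>; exchanging the two integrals leaves the tail of \<open>Y\<close> at each
  level \<open>y\<close>.\<close>

lemma (in prob_space) nn_expectation_one_minus_exp:
  assumes [measurable]: "Y \<in> borel_measurable M" and "AE \<omega> in M. 0 \<le> Y \<omega>"
  shows "(\<integral>\<^sup>+\<omega>. ennreal (1 - exp (- Y \<omega>)) \<partial>M)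
       = (\<integral>\<^sup>+y. ennreal (indicator {0<..} y * exp (- y)) * emeasure M {\<omega>\<in>space M. y < Y \<omega>} \<partial>lborel)"
proof -
  interpret pair_sigma_finite lborel M ..
  have "(\<integral>\<^sup>+\<omega>. ennreal (1 - exp (- Y \<omega>)) \<partial>M)
      = (\<integral>\<^sup>+\<omega>. (\<integral>\<^sup>+y. ennreal (indicator {0<..} y * exp (- y)) * indicator {..<Y \<omega>} y \<partial>lborel) \<partial>M)"
    by (rule nn_integral_cong_AE) (use assms(2) in eventually_elim, simp add: nn_integral_exp_upto)
  also have "\<dots> = (\<integral>\<^sup>+y. (\<integral>\<^sup>+\<omega>. ennreal (indicator {0<..} y * exp (- y)) * indicator {..<Y \<omega>} y \<partial>M) \<partial>lborel)"
    \<comment> \<open>Unfolded, the indicator becomes the predicate \<open>y < Y \<omega>\<close>,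
      which is jointly measurable, whereas the set \<open>{..<Y \<omega>}\<close> moves with
      \<omega>.\<close>
    unfolding lessThan_def indicator_def by (rule Fubini') measurable
  also have "\<dots> = (\<integral>\<^sup>+y. ennreal (indicator {0<..} y * exp (- y)) * emeasure M {\<omega>\<in>space M. y < Y \<omega>} \<partial>lborel)"
  proof (rule nn_integral_cong)
    fix y :: real
    have "(\<integral>\<^sup>+\<omega>. indicator {..<Y \<omega>} y \<partial>M) = (\<integral>\<^sup>+\<omega>. indicator {\<omega>\<in>space M. y < Y \<omega>} \<omega> \<partial>M)"
      by (rule nn_integral_cong) (auto simp: indicator_def)
    also have "\<dots> = emeasure M {\<omega>\<in>space M. y < Y \<omega>}"
      by (rule nn_integral_indicator) measurable
    finally have "(\<integral>\<^sup>+\<omega>. indicator {..<Y \<omega>} y \<partial>M) = emeasure M {\<omega>\<in>space M. y < Y \<omega>}" .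
    moreover have "(\<lambda>\<omega>. indicator {..<Y \<omega>} y :: ennreal) \<in> borel_measurable M"
      unfolding lessThan_def indicator_def by measurable
    ultimately show "(\<integral>\<^sup>+\<omega>. ennreal (indicator {0<..} y * exp (- y)) * indicator {..<Y \<omega>} y \<partial>M)
      = ennreal (indicator {0<..} y * exp (- y)) * emeasure M {\<omega>\<in>space M. y < Y \<omega>}"
      by (simp only: nn_integral_cmult)
  qed
  finally show ?thesis .
qed

section \<open>The Laplace transform of one step with power tail\<close>

lemma (in prob_space) power_tail_AE_pos:
  assumes "power_tail M \<gamma> \<alpha> X" "0 < \<gamma>"
  shows "AE \<omega> in M. 0 < X \<omega>"
proof -
  \<comment> \<open>The level \<open>0\<close> lies below \<gamma>, where the tail probability is
    one.\<close>
  have [measurable]: "X \<in> borel_measurable M" and "prob {\<omega>\<in>space M. X \<omega> > 0} = 1"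
    using assms by (auto simp: power_tail_def)
  then show ?thesis
    by (subst (asm) prob_Collect_eq_1) auto
qed

lemma (in prob_space) power_tail_prob_power_gt:
  assumes tail: "power_tail M \<gamma> (\<beta> * real n) X" and "0 < \<gamma>" "0 < c" "0 < n" "0 < \<beta>" "0 < y"
    and ne: "y \<noteq> c * \<gamma> ^ n" \<comment> \<open>\<open>power_tail\<close> leaves the tail at \<open>\<gamma>\<close> itself unspecified\<close>
  shows "prob {\<omega>\<in>space M. y < c * \<bar>X \<omega>\<bar> ^ n} = min 1 (\<gamma> powr (\<beta> * real n) * (y / c) powr (- \<beta>))"
proof -
  have [measurable]: "X \<in> borel_measurable M" using tail by (simp add: power_tail_def)
  \<comment> \<open>\<open>w\<close> is the point at which \<open>c * x ^ n\<close> reaches the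
    level \<open>y\<close>, so that the event becomes a tail event of \<open>X\<close>
    itself.\<close>
  define w where "w = (y / c) powr (1 / real n)"
  have w: "0 < w" "w ^ n = y / c"
    using assms by (simp_all add: w_def powr_realpow[symmetric] powr_powr)
  have "y < c * x ^ n \<longleftrightarrow> w < x" if "0 < x" for x
  proof -
    have "y < c * x ^ n \<longleftrightarrow> w ^ n < x ^ n"
      using \<open>0 < c\<close> unfolding w(2) by (simp add: field_simps)
    also have "\<dots> \<longleftrightarrow> w < x" using w(1) that \<open>0 < n\<close>
      by (meson less_imp_le power_less_imp_less_base power_strict_mono)
    finally show ?thesis .
  qed
  then have "prob {\<omega>\<in>space M. y < c * \<bar>X \<omega>\<bar> ^ n} = prob {\<omega>\<in>space M. w < X \<omega>}"
    by (intro measure_eq_AE) (use power_tail_AE_pos[OF tail \<open>0 < \<gamma>\<close>] in \<open>eventually_elim, auto\<close>, measurable)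
  moreover have "(\<gamma> / w) powr (\<beta> * real n) = \<gamma> powr (\<beta> * real n) * (y / c) powr (- \<beta>)"
  proof -
    have "w powr (\<beta> * real n) = (y / c) powr \<beta>"
      using \<open>0 < n\<close> by (simp add: w_def powr_powr)
    then show ?thesis
      using \<open>0 < \<gamma>\<close> w(1) by (simp add: powr_divide powr_minus_divide)
  qed
  moreover have "w \<noteq> \<gamma>" using w ne \<open>0 < c\<close> by (auto simp: field_simps)
  \<comment> \<open>The minimum merges the two clauses of the tail: for \<open>w < \<gamma>\<close>
    the power is at least one and the probability is one, and for \<open>w > \<gamma>\<close> the
    power is the probability.\<close>
  moreover have "prob {\<omega>\<in>space M. w < X \<omega>} = min 1 ((\<gamma> / w) powr (\<beta> * real n))" if "w \<noteq> \<gamma>"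
  proof (cases "w < \<gamma>")
    case True
    then have "1 \<le> (\<gamma> / w) powr (\<beta> * real n)"
      using assms w by (intro ge_one_powr_ge_zero) auto
    then show ?thesis using True tail by (simp add: power_tail_def)
  next
    case False
    then have "(\<gamma> / w) powr (\<beta> * real n) \<le> 1"
      using assms w by (intro powr_le1) auto
    then show ?thesis using False that tail by (simp add: power_tail_def)
  qed
  ultimately show ?thesis by simp
qed

text \<open>Multiplying the tail of \<open>c * \<bar>X\<bar> ^ n\<close> by the clock scale cancels
  the power of \<gamma> in front of \<open>(y / c) powr (- \<beta>)\<close> and turns the bound
  \<open>1\<close> into that scale. On the right \<gamma> survives only as a truncation
  level.\<close>

lemma (in prob_space) power_tail_laplace:
  assumes tail: "power_tail M \<gamma> (\<beta> * real n) X" and pos: "0 < \<gamma>" "0 < c" "0 < n" "0 < \<beta>"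
  shows "\<gamma> powr (- (\<beta> * real n)) * (1 - expectation (\<lambda>\<omega>. exp (- c * \<bar>X \<omega>\<bar> ^ n)))
       = (\<integral>y. indicator {0<..} y * (exp (- y) * min (\<gamma> powr (- (\<beta> * real n))) ((y / c) powr (- \<beta>))) \<partial>lborel)"
    (is "?r * _ = integral\<^sup>L lborel ?g")
proof -
  have [measurable]: "X \<in> borel_measurable M" using tail by (simp add: power_tail_def)
  have r: "0 < ?r" "?r * \<gamma> powr (\<beta> * real n) = 1"
    using pos by (auto simp: powr_minus)
  have int: "integrable M (\<lambda>\<omega>. exp (- c * \<bar>X \<omega>\<bar> ^ n))"
    by (rule integrable_const_bound[where B = 1]) (use pos in auto)
  have "?r * (1 - expectation (\<lambda>\<omega>. exp (- c * \<bar>X \<omega>\<bar> ^ n)))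
      = (\<integral>\<omega>. ?r * (1 - exp (- c * \<bar>X \<omega>\<bar> ^ n)) \<partial>M)"
    using int by (simp add: prob_space)
  also have "\<dots> = enn2real (\<integral>\<^sup>+\<omega>. ennreal (?r * (1 - exp (- c * \<bar>X \<omega>\<bar> ^ n))) \<partial>M)"
    by (rule integral_eq_nn_integral) (use pos in auto)
  also have "(\<integral>\<^sup>+\<omega>. ennreal (?r * (1 - exp (- c * \<bar>X \<omega>\<bar> ^ n))) \<partial>M)
      = ennreal ?r * (\<integral>\<^sup>+\<omega>. ennreal (1 - exp (- (c * \<bar>X \<omega>\<bar> ^ n))) \<partial>M)"
    using r by (simp add: ennreal_mult' nn_integral_cmult)
  also have "\<dots> = ennreal ?r * (\<integral>\<^sup>+y. ennreal (indicator {0<..} y * exp (- y))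
      * emeasure M {\<omega>\<in>space M. y < c * \<bar>X \<omega>\<bar> ^ n} \<partial>lborel)"
    by (subst nn_expectation_one_minus_exp) (use pos in auto)
  also have "\<dots> = (\<integral>\<^sup>+y. ennreal ?r * (ennreal (indicator {0<..} y * exp (- y))
      * emeasure M {\<omega>\<in>space M. y < c * \<bar>X \<omega>\<bar> ^ n}) \<partial>lborel)"
    by (rule nn_integral_cmult[symmetric]) measurable
  also have "\<dots> = (\<integral>\<^sup>+y. ennreal (?g y) \<partial>lborel)"
  proof (rule nn_integral_cong_AE)
    show "AE y in lborel. ennreal ?r * (ennreal (indicator {0<..} y * exp (- y))
      * emeasure M {\<omega>\<in>space M. y < c * \<bar>X \<omega>\<bar> ^ n}) = ennreal (?g y)"
      \<comment> \<open>The level excluded from the tail formula is a single point, hence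
        null.\<close>
      using AE_lborel_singleton[of "c * \<gamma> ^ n"]
    proof eventually_elim
      case (elim y)
      show ?case
      proof (cases "0 < y")
        case True
        define p where "p = prob {\<omega>\<in>space M. y < c * \<bar>X \<omega>\<bar> ^ n}"
        have "?r * p = min ?r (?r * \<gamma> powr (\<beta> * real n) * (y / c) powr (- \<beta>))"
          unfolding p_def
          using power_tail_prob_power_gt[OF tail pos True elim] r(1) by (simp add: min_mult_distrib_left mult.assoc)
        then have "?r * p = min ?r ((y / c) powr (- \<beta>))" by (simp only: r(2) mult_1)
        moreover have "0 \<le> p" by (simp add: p_def)
        ultimately show ?thesis
          using True r(1) by (simp add: emeasure_eq_measure p_def[symmetric] ennreal_mult'[symmetric] ac_simps)
      qed simp
    qed
  qed
  also have "enn2real \<dots> = integral\<^sup>L lborel ?g"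
    by (rule integral_eq_nn_integral[symmetric]) auto
  finally show ?thesis .
qed

section \<open>The limit of the rescaled Laplace transform\<close>

lemma Gamma_lborel_real:
  fixes s :: real
  assumes "0 < s"
  shows "has_bochner_integral lborel (\<lambda>y. indicator {0<..} y * (exp (- y) * y powr (s - 1))) (Gamma s)"
proof (rule has_bochner_integral_nn_integral)
  show "(\<integral>\<^sup>+y. ennreal (indicator {0<..} y * (exp (- y) * y powr (s - 1))) \<partial>lborel) = ennreal (Gamma s)"
    unfolding Gamma_conv_nn_integral_real[OF assms]
    by (rule nn_integral_cong) (auto simp: indicator_def exp_minus divide_inverse)
  show "0 \<le> Gamma s" using Gamma_real_pos[OF assms] by simp
qed auto

text \<open>The integrand without truncation dominates; it is \<open>c powr \<beta>\<close> times
  the Gamma integrand at \<open>1 - \<beta>\<close>, integrable because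
  \<open>\<beta> < 1\<close>.\<close>

lemma truncated_Gamma_tendsto:
  fixes c \<beta> :: real
  assumes "0 < c" "0 < \<beta>" "\<beta> < 1"
  shows "((\<lambda>r. \<integral>y. indicator {0<..} y * (exp (- y) * min r ((y / c) powr (- \<beta>))) \<partial>lborel)
           \<longlongrightarrow> c powr \<beta> * Gamma (1 - \<beta>)) at_top"
proof -
  let ?f = "\<lambda>y. indicator {0<..} y * (exp (- y) * (y / c) powr (- \<beta>))"
  have eq: "?f = (\<lambda>y. c powr \<beta> * (indicator {0<..} y * (exp (- y) * y powr ((1 - \<beta>) - 1))))"
    using assms by (auto simp: indicator_def powr_divide powr_minus field_simps)
  have "has_bochner_integral lborel ?f (c powr \<beta> * Gamma (1 - \<beta>))"
    unfolding eq by (intro has_bochner_integral_mult_right Gamma_lborel_real) (use assms in auto)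
  then have int: "integrable lborel ?f" and val: "integral\<^sup>L lborel ?f = c powr \<beta> * Gamma (1 - \<beta>)"
    by (auto simp: has_bochner_integral_iff)
  show ?thesis unfolding val[symmetric]
  proof (rule integral_dominated_convergence_at_top[where w = ?f])
    show "\<forall>\<^sub>F r in at_top. AE y in lborel.
        norm (indicator {0<..} y * (exp (- y) * min r ((y / c) powr (- \<beta>)))) \<le> ?f y"
      using eventually_ge_at_top[of 0] by eventually_elim (auto simp: indicator_def)
    \<comment> \<open>At each fixed \<open>y\<close> the truncation is inactive as soon as
      \<open>r\<close> exceeds \<open>(y / c) powr (- \<beta>)\<close>.\<close>
    show "AE y in lborel. ((\<lambda>r. indicator {0<..} y * (exp (- y) * min r ((y / c) powr (- \<beta>)))) \<longlongrightarrow> ?f y) at_top"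
    proof (rule AE_I2, rule tendsto_eventually)
      fix y show "\<forall>\<^sub>F r in at_top. indicator {0<..} y * (exp (- y) * min r ((y / c) powr (- \<beta>))) = ?f y"
        using eventually_ge_at_top[of "(y / c) powr (- \<beta>)"] by eventually_elim (simp add: min_def)
    qed
  qed (use int in auto)
qed

lemma filterlim_powr_neg_at_top_at_right_0:
  fixes \<alpha> :: real
  assumes "0 < \<alpha>"
  shows "filterlim (\<lambda>x. x powr (- \<alpha>)) at_top (at_right 0)"
proof -
  have "filterlim (\<lambda>x::real. - ln x) at_top (at_right 0)"
    using ln_at_0 by (simp add: filterlim_uminus_at_bot)
  then have "filterlim (\<lambda>x. exp (\<alpha> * - ln x)) at_top (at_right 0)"
    by (intro filterlim_compose[OF exp_at_top] filterlim_tendsto_pos_mult_at_top[OF tendsto_const assms])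
  then show ?thesis
    by (rule filterlim_mono_eventually)
       (use eventually_at_right_less[of 0] in \<open>auto simp: powr_def elim!: eventually_mono\<close>)
qed

lemma (in prob_space) power_tail_laplace_tendsto:
  assumes tail: "\<And>\<gamma>. 0 < \<gamma> \<Longrightarrow> power_tail M \<gamma> (\<beta> * real n) (X \<gamma>)"
    and pos: "0 \<le> c" "0 < n" "0 < \<beta>" "\<beta> < 1"
  shows "((\<lambda>\<gamma>. \<gamma> powr (- (\<beta> * real n)) * (1 - expectation (\<lambda>\<omega>. exp (- c * \<bar>X \<gamma> \<omega>\<bar> ^ n))))
           \<longlongrightarrow> c powr \<beta> * Gamma (1 - \<beta>)) (at_right 0)"
\<comment> \<open>The integral formula requires \<open>c > 0\<close>. For \<open>c = 0\<close>,
  which occurs at \<open>\<xi> = 0\<close>, both sides vanish since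
  \<open>0 powr \<beta> = 0\<close>.\<close>
proof (cases "c = 0")
  case False
  then have c: "0 < c" using pos by simp
  have "filterlim (\<lambda>\<gamma>::real. \<gamma> powr (- (\<beta> * real n))) at_top (at_right 0)"
    using pos by (intro filterlim_powr_neg_at_top_at_right_0) auto
  from filterlim_compose[OF truncated_Gamma_tendsto[OF c pos(3,4)] this]
  show ?thesis
    by (rule Lim_transform_eventually)
       (use eventually_at_right_less[of 0] in eventually_elim, use power_tail_laplace[OF tail _ c pos(2,3)] in simp)
qed (simp add: prob_space)

section \<open>Products of random length driven by Poisson clocks\<close>

lemma (in prob_space) poisson_process_prob:
  assumes "poisson_process M rate N" "0 < rate" "0 < s"
  shows "prob {\<omega>\<in>space M. N s \<omega> = n} = (rate * s) ^ n / fact n * exp (- (rate * s))"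
proof -
  have [measurable]: "N s \<in> measurable M (count_space UNIV)" "N 0 \<in> measurable M (count_space UNIV)"
    and dist: "distr M (count_space UNIV) (\<lambda>\<omega>. N s \<omega> - N 0 \<omega>) = measure_pmf (poisson_pmf (rate * (s - 0)))"
    and start: "AE \<omega> in M. N 0 \<omega> = 0"
    using assms(1,3) by (simp_all add: poisson_process_def)
  \<comment> \<open>Only increments have a prescribed law; since \<open>N 0\<close> vanishes almost
    surely, \<open>N s\<close> is almost surely the increment from time \<open>0\<close>.\<close>
  have "prob {\<omega>\<in>space M. N s \<omega> = n} = prob ((\<lambda>\<omega>. N s \<omega> - N 0 \<omega>) -` {n} \<inter> space M)"
    by (rule measure_eq_AE) (use start in \<open>eventually_elim, auto\<close>, measurable)
  also have "\<dots> = measure (distr M (count_space UNIV) (\<lambda>\<omega>. N s \<omega> - N 0 \<omega>)) {n}"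
    by (rule measure_distr[symmetric]) auto
  also have "\<dots> = pmf (poisson_pmf (rate * s)) n"
    by (simp add: dist measure_pmf_single)
  finally show ?thesis using assms by simp
qed

text \<open>This is the generating function of the Poisson law at \<open>x\<close>. The exponent
  \<open>Suc n\<close>, and with it the extra factor \<open>x\<close>, is there because sums
  starting at index \<open>0\<close> have one term more than the clock has counted.\<close>

lemma suminf_poisson_power:
  fixes r x :: real
  assumes "0 \<le> r" "0 \<le> x"
  shows "(\<Sum>n. ennreal (r ^ n / fact n * exp (- r) * x ^ Suc n)) = ennreal (x * exp (- r * (1 - x)))"
proof (rule suminf_ennreal_eq)
  have "(\<lambda>n. x * exp (- r) * ((r * x) ^ n /\<^sub>R fact n)) sums (x * exp (- r) * exp (r * x))"
    by (intro sums_mult exp_converges)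
  then show "(\<lambda>n. r ^ n / fact n * exp (- r) * x ^ Suc n) sums (x * exp (- r * (1 - x)))"
    by (simp add: field_simps power_mult_distrib exp_diff exp_minus exp_add)
qed (use assms in auto)

text \<open>Each variable generates no more events than its source, and shrinking the event families
  preserves independence. \<open>rec_source\<close> packs the four kinds of variables into the
  single indexed family to which mutual independence refers.\<close>

lemma (in prob_space) mutually_independent_indep_vars:
  fixes f g :: "real \<Rightarrow> real" and F G :: "nat \<Rightarrow> real"
  assumes ind: "mutually_independent M X Y N N'"
    and "\<And>j. X j \<in> borel_measurable M" "\<And>j. Y j \<in> borel_measurable M"
    and "N s \<in> measurable M (count_space UNIV)" "N' s' \<in> measurable M (count_space UNIV)"
    and "f \<in> borel_measurable borel" "g \<in> borel_measurable borel" and "0 \<le> s" "0 \<le> s'"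
  shows "indep_vars (\<lambda>_. borel) (rec_source (\<lambda>j \<omega>. f (X j \<omega>)) (\<lambda>j \<omega>. g (Y j \<omega>))
      (\<lambda>\<omega>. F (N s \<omega>)) (\<lambda>\<omega>. G (N' s' \<omega>))) UNIV"
    (is "indep_vars _ ?Z _")
  unfolding indep_vars_def2
proof (intro conjI ballI)
  note [measurable] = assms(2-7)
  show "random_variable borel (?Z i)" for i :: source
    by (cases i) simp_all
  show "indep_sets (\<lambda>i. {?Z i -` A \<inter> space M |A. A \<in> sets borel}) UNIV"
  proof (rule indep_sets_mono_sets[OF ind[unfolded mutually_independent_def]])
    fix i :: source
    have borel_pre: "{(\<lambda>\<omega>. h (V \<omega>)) -` A \<inter> space M |A. A \<in> sets borel} \<subseteq> rv_events M V"
      if "h \<in> borel_measurable borel" for h :: "real \<Rightarrow> real" and V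
    proof clarify
      fix A :: "real set" assume "A \<in> sets borel"
      then have "h -` A \<in> sets borel" using that by (rule measurable_sets_borel[rotated])
      moreover have "(\<lambda>\<omega>. h (V \<omega>)) -` A \<inter> space M = V -` (h -` A) \<inter> space M" by auto
      ultimately show "(\<lambda>\<omega>. h (V \<omega>)) -` A \<inter> space M \<in> rv_events M V"
        unfolding rv_events_def by blast
    qed
    have count_pre: "{(\<lambda>\<omega>. H (K u \<omega>)) -` A \<inter> space M |A. A \<in> sets borel} \<subseteq> process_events M K"
      if "0 \<le> u" for H :: "nat \<Rightarrow> real" and K u
    proof clarify
      fix A :: "real set"
      have "(\<lambda>\<omega>. H (K u \<omega>)) -` A \<inter> space M = K u -` (H -` A) \<inter> space M" by auto
      then show "(\<lambda>\<omega>. H (K u \<omega>)) -` A \<inter> space M \<in> process_events M K"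
        unfolding process_events_def using that by (intro sigma_sets.Basic) blast
    qed
    show "{?Z i -` A \<inter> space M |A. A \<in> sets borel} \<subseteq> source_events M X Y N N' i"
      by (cases i) (use assms in \<open>auto intro!: borel_pre count_pre simp del: Collect_mono_iff\<close>)
  qed
qed

text \<open>Splitting by the values of both clocks makes the products of fixed length, so that
  independence factorises each piece. Working in \<open>ennreal\<close> lets the double sum pass
  through the integral and split into two sums without convergence questions.\<close>

lemma (in prob_space) nn_expectation_two_random_products:
  fixes f g :: "real \<Rightarrow> real"
  assumes ind: "mutually_independent M X Y N N'"
    and m: "\<And>j. X j \<in> borel_measurable M" "\<And>j. Y j \<in> borel_measurable M"
      "N s \<in> measurable M (count_space UNIV)" "N' s' \<in> measurable M (count_space UNIV)"
      "f \<in> borel_measurable borel" "g \<in> borel_measurable borel"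
    and "0 \<le> s" "0 \<le> s'"
    and f: "\<And>x. 0 \<le> f x" "\<And>x. f x \<le> 1" "\<And>j. expectation (\<lambda>\<omega>. f (X j \<omega>)) = a"
    and g: "\<And>x. 0 \<le> g x" "\<And>x. g x \<le> 1" "\<And>j. expectation (\<lambda>\<omega>. g (Y j \<omega>)) = b"
  shows "(\<integral>\<^sup>+\<omega>. ennreal ((\<Prod>j\<le>N s \<omega>. f (X j \<omega>)) * (\<Prod>j\<le>N' s' \<omega>. g (Y j \<omega>))) \<partial>M)
    = (\<Sum>n. ennreal (prob {\<omega>\<in>space M. N s \<omega> = n} * a ^ Suc n))
      * (\<Sum>n. ennreal (prob {\<omega>\<in>space M. N' s' \<omega> = n} * b ^ Suc n))"
proof -
  note [measurable] = m
  have ab: "0 \<le> a" "0 \<le> b" using f g by (auto simp flip: f(3)[of 0] g(3)[of 0] intro: integral_nonneg_AE)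
  \<comment> \<open>The contribution of the outcomes at which the clocks read \<open>n\<close> and
    \<open>m\<close>.\<close>
  define P where "P n m \<omega> = (\<Prod>j\<le>n. f (X j \<omega>)) * (\<Prod>j\<le>m. g (Y j \<omega>))
      * (indicator {n} (N s \<omega>) * indicator {m} (N' s' \<omega>))" for n m \<omega>
  have P0: "0 \<le> P n m \<omega>" for n m \<omega> using f g by (auto simp: P_def prod_nonneg)
  have [measurable]: "(\<lambda>\<omega>. indicator {n} (N s \<omega>) :: real) \<in> borel_measurable M"
    "(\<lambda>\<omega>. indicator {n} (N' s' \<omega>) :: real) \<in> borel_measurable M" for n
    by (rule measurable_compose[OF m(3)] measurable_compose[OF m(4)], simp)+
  have [measurable]: "P n m \<in> borel_measurable M" for n m
    unfolding P_def by measurable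
  have fin: "(\<integral>\<^sup>+\<omega>. ennreal (P n m \<omega>) \<partial>M)
      = ennreal (prob {\<omega>\<in>space M. N s \<omega> = n} * a ^ Suc n) * ennreal (prob {\<omega>\<in>space M. N' s' \<omega> = m} * b ^ Suc m)"
    for n m
  proof -
    \<comment> \<open>The indicators of the clock values join the independent family as two further
      members, so \<open>P n m\<close> is a finite product of independent bounded variables, indexed
      by \<open>I\<close>.\<close>
    define Z where "Z = rec_source (\<lambda>j \<omega>. f (X j \<omega>)) (\<lambda>j \<omega>. g (Y j \<omega>))
      (\<lambda>\<omega>. indicator {n} (N s \<omega>)) (\<lambda>\<omega>. indicator {m} (N' s' \<omega>) :: real)"
    define I where "I = (StepX ` {..n} \<union> StepY ` {..m}) \<union> {ClockX, ClockY}"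
    have split: "(\<Prod>i\<in>I. H i) = (\<Prod>j\<le>n. H (StepX j)) * (\<Prod>j\<le>m. H (StepY j)) * (H ClockX * H ClockY)"
      for H :: "source \<Rightarrow> real"
    proof -
      have "prod H I = prod H (StepX ` {..n} \<union> StepY ` {..m}) * prod H {ClockX, ClockY}"
        unfolding I_def by (rule prod.union_disjoint) auto
      also have "prod H (StepX ` {..n} \<union> StepY ` {..m}) = prod H (StepX ` {..n}) * prod H (StepY ` {..m})"
        by (rule prod.union_disjoint) auto
      finally show ?thesis by (simp add: prod.reindex inj_on_def)
    qed
    have ex: "expectation (\<lambda>\<omega>. indicator A (K \<omega>)) = prob {\<omega>\<in>space M. K \<omega> \<in> A}"
      if [measurable]: "K \<in> measurable M (count_space UNIV)" for K :: "'a \<Rightarrow> nat" and A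
    proof -
      have "expectation (\<lambda>\<omega>. indicator A (K \<omega>)) = expectation (indicator {\<omega>\<in>space M. K \<omega> \<in> A} :: 'a \<Rightarrow> real)"
        by (rule Bochner_Integration.integral_cong) (auto simp: indicator_def)
      then show ?thesis by simp
    qed
    have "indep_vars (\<lambda>_. borel) Z UNIV"
      unfolding Z_def by (rule mutually_independent_indep_vars) (use assms in auto)
    then have ivI: "indep_vars (\<lambda>_. borel) Z I" by (rule indep_vars_subset) auto
    have int: "integrable M (Z i)" for i
      by (rule integrable_const_bound[where B = 1])
         (cases i; use f g in \<open>auto simp: Z_def indicator_def\<close>)+
    have PZ: "P n m \<omega> = (\<Prod>i\<in>I. Z i \<omega>)" for \<omega>
      unfolding split by (simp add: P_def Z_def)
    have "finite I" by (simp add: I_def)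
    then have "expectation (P n m) = (\<Prod>i\<in>I. expectation (Z i))" "integrable M (P n m)"
      unfolding PZ[abs_def] using indep_vars_lebesgue_integral[OF _ ivI int] indep_vars_integrable[OF _ ivI int] by auto
    moreover have "(\<Prod>i\<in>I. expectation (Z i))
        = (prob {\<omega>\<in>space M. N s \<omega> = n} * a ^ Suc n) * (prob {\<omega>\<in>space M. N' s' \<omega> = m} * b ^ Suc m)"
      unfolding split using ex[OF m(3), of "{n}"] ex[OF m(4), of "{m}"] by (simp add: Z_def f(3) g(3))
    ultimately show ?thesis using ab by (simp add: nn_integral_eq_integral P0 ennreal_mult)
  qed
  have "(\<integral>\<^sup>+\<omega>. ennreal ((\<Prod>j\<le>N s \<omega>. f (X j \<omega>)) * (\<Prod>j\<le>N' s' \<omega>. g (Y j \<omega>))) \<partial>M)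
      = (\<integral>\<^sup>+\<omega>. (\<Sum>n. \<Sum>m. ennreal (P n m \<omega>)) \<partial>M)"
  proof (rule nn_integral_cong)
    fix \<omega>
    \<comment> \<open>For a given \<omega> the indicators kill every pair except the actual clock
      readings.\<close>
    have "(\<Sum>n. \<Sum>m. ennreal (P n m \<omega>)) = (\<Sum>n. ennreal (P n (N' s' \<omega>) \<omega>))"
      by (rule suminf_cong, subst suminf_finite[of "{N' s' \<omega>}"]) (auto simp: P_def)
    also have "\<dots> = ennreal (P (N s \<omega>) (N' s' \<omega>) \<omega>)"
      by (subst suminf_finite[of "{N s \<omega>}"]) (auto simp: P_def)
    finally show "ennreal ((\<Prod>j\<le>N s \<omega>. f (X j \<omega>)) * (\<Prod>j\<le>N' s' \<omega>. g (Y j \<omega>))) = (\<Sum>n. \<Sum>m. ennreal (P n m \<omega>))"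
      by (simp add: P_def)
  qed
  also have "\<dots> = (\<Sum>n. \<Sum>m. \<integral>\<^sup>+\<omega>. ennreal (P n m \<omega>) \<partial>M)"
    by (simp add: nn_integral_suminf)
  also have "\<dots> = (\<Sum>n. ennreal (prob {\<omega>\<in>space M. N s \<omega> = n} * a ^ Suc n))
      * (\<Sum>n. ennreal (prob {\<omega>\<in>space M. N' s' \<omega> = n} * b ^ Suc n))"
    unfolding fin by (simp only: ennreal_suminf_cmult ennreal_suminf_multc)
  finally show ?thesis .
qed

lemma (in prob_space) expectation_two_poisson_products:
  fixes f g :: "real \<Rightarrow> real"
  assumes ind: "mutually_independent M X Y N N'"
    and m: "\<And>j. X j \<in> borel_measurable M" "\<And>j. Y j \<in> borel_measurable M"
      "f \<in> borel_measurable borel" "g \<in> borel_measurable borel"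
    and poi: "poisson_process M rate N" "poisson_process M rate N'" "0 < rate" "0 < s"
    and f: "\<And>x. 0 \<le> f x" "\<And>x. f x \<le> 1" "\<And>j. expectation (\<lambda>\<omega>. f (X j \<omega>)) = a"
    and g: "\<And>x. 0 \<le> g x" "\<And>x. g x \<le> 1" "\<And>j. expectation (\<lambda>\<omega>. g (Y j \<omega>)) = b"
  shows "expectation (\<lambda>\<omega>. (\<Prod>j\<le>N s \<omega>. f (X j \<omega>)) * (\<Prod>j\<le>N' s \<omega>. g (Y j \<omega>)))
    = a * exp (- (rate * s) * (1 - a)) * (b * exp (- (rate * s) * (1 - b)))"
proof -
  have Ns[measurable]: "N s \<in> measurable M (count_space UNIV)" "N' s \<in> measurable M (count_space UNIV)"
    using poi by (simp_all add: poisson_process_def)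
  note [measurable] = m
  have ab: "0 \<le> a" "0 \<le> b" using f g by (auto simp flip: f(3)[of 0] g(3)[of 0] intro: integral_nonneg_AE)
  have "(\<integral>\<^sup>+\<omega>. ennreal ((\<Prod>j\<le>N s \<omega>. f (X j \<omega>)) * (\<Prod>j\<le>N' s \<omega>. g (Y j \<omega>))) \<partial>M)
      = ennreal (a * exp (- (rate * s) * (1 - a))) * ennreal (b * exp (- (rate * s) * (1 - b)))"
    unfolding nn_expectation_two_random_products[OF ind m(1,2) Ns m(3,4) less_imp_le[OF poi(4)] less_imp_le[OF poi(4)] f g]
      poisson_process_prob[OF poi(1,3,4)] poisson_process_prob[OF poi(2,3,4)]
    by (intro arg_cong2[where f = "(*)"] suminf_poisson_power ab) (use poi(3,4) in simp_all)
  \<comment> \<open>The number of factors depends on \<omega>, but takes countably many values, for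
    each of which the product is measurable.\<close>
  moreover have "(\<lambda>\<omega>. (\<Prod>j\<le>N s \<omega>. f (X j \<omega>)) * (\<Prod>j\<le>N' s \<omega>. g (Y j \<omega>))) \<in> borel_measurable M"
    by (intro borel_measurable_times;
        rule measurable_compose_countable[where f = "\<lambda>n \<omega>. \<Prod>j\<le>n. _ j \<omega>"]) measurable
  ultimately show ?thesis
    using ab f g by (subst integral_eq_nn_integral) (auto simp: prod_nonneg enn2real_mult)
qed

section \<open>Integrating out the pseudo random variables\<close>

lemma pseudo_ft_walks:
  assumes "pseudoprocess_density k u"
  shows "pseudo_ft M (\<lambda>x. u x 1) (walks_index N N' \<tau>) (walks_sum a b X Y N N' \<tau>) \<xi>
    = complex_of_real (\<integral>\<omega>. (\<Prod>j\<le>N \<tau> \<omega>. exp (- (\<bar>\<xi> * a\<bar> ^ (2 * k)) * \<bar>X j \<omega>\<bar> ^ (2 * k)))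
        * (\<Prod>j\<le>N' \<tau> \<omega>. exp (- (\<bar>\<xi> * b\<bar> ^ (2 * k)) * \<bar>Y j \<omega>\<bar> ^ (2 * k))) \<partial>M)"
proof -
  have int: "integrable lborel (\<lambda>x. u x 1)"
    and ft: "signed_ft (\<lambda>x. u x 1) z = complex_of_real (exp (- (\<bar>z\<bar> ^ (2 * k))))" for z
    using assms by (auto simp: pseudoprocess_density_def)
  have "(\<integral>y. iexp (\<xi> * walks_sum a b X Y N N' \<tau> \<omega> y)
        * complex_of_real (\<Prod>i\<in>walks_index N N' \<tau> \<omega>. u (y i) 1) \<partial>PiM (walks_index N N' \<tau> \<omega>) (\<lambda>_. lborel))
      = complex_of_real ((\<Prod>j\<le>N \<tau> \<omega>. exp (- (\<bar>\<xi> * a\<bar> ^ (2 * k)) * \<bar>X j \<omega>\<bar> ^ (2 * k)))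
        * (\<Prod>j\<le>N' \<tau> \<omega>. exp (- (\<bar>\<xi> * b\<bar> ^ (2 * k)) * \<bar>Y j \<omega>\<bar> ^ (2 * k))))" for \<omega>
  proof -
    \<comment> \<open>For fixed \<omega> the exponent is a linear form in the pseudo variables with
      coefficients \<open>c\<close>. Hence the inner integral is a product of transforms of
      \<open>u\<close> at time \<open>1\<close>, all of them real.\<close>
    define c where "c = case_sum (\<lambda>j. \<xi> * a * X j \<omega>) (\<lambda>j. \<xi> * b * Y j \<omega>)"
    have fin: "finite (walks_index N N' \<tau> \<omega>)" by (simp add: walks_index_def)
    have "\<xi> * walks_sum a b X Y N N' \<tau> \<omega> y = (\<Sum>i\<in>walks_index N N' \<tau> \<omega>. c i * y i)" for y
      unfolding walks_index_def walks_sum_def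
      by (subst sum.Plus) (auto simp: c_def atMost_atLeast0 sum_distrib_left distrib_left ac_simps)
    then show ?thesis
      using signed_ft_independent_sum[OF fin int, of c]
      by (simp add: walks_index_def prod.Plus ft c_def abs_mult power_mult_distrib mult.assoc)
  qed
  then show ?thesis unfolding pseudo_ft_def by (simp only: integral_complex_of_real)
qed

section \<open>The weights and the limit of a single walk\<close>

lemma skew_weights_sum:
  fixes \<beta> \<theta> :: real
  assumes "sin (pi * \<beta>) \<noteq> 0"
  shows "sin (pi / 2 * (\<beta> - \<theta>)) / sin (pi * \<beta>) + sin (pi / 2 * (\<beta> + \<theta>)) / sin (pi * \<beta>)
    = cos (pi / 2 * \<theta>) / cos (pi / 2 * \<beta>)"
proof -
  have s: "sin (pi * \<beta>) = 2 * sin (pi / 2 * \<beta>) * cos (pi / 2 * \<beta>)"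
    using sin_double[of "pi / 2 * \<beta>"] by simp
  have "sin (pi / 2 * (\<beta> - \<theta>)) + sin (pi / 2 * (\<beta> + \<theta>)) = 2 * sin (pi / 2 * \<beta>) * cos (pi / 2 * \<theta>)"
    by (simp add: distrib_left right_diff_distrib sin_add sin_diff)
  \<comment> \<open>The common factor \<open>2 * sin (pi / 2 * \<beta>)\<close> cancels; it is
    nonzero because \<open>sin (pi * \<beta>)\<close> is.\<close>
  then show ?thesis using assms unfolding s by (simp add: add_divide_distrib[symmetric])
qed

text \<open>The integral in \<open>power_tail_laplace\<close> sees the variable only through its
  tail. This supplies the common mean of the factors over all steps \<open>j\<close> that the
  product lemmas require.\<close>

lemma (in prob_space) power_tail_laplace_eq:
  assumes "power_tail M \<gamma> (\<beta> * real n) X" "power_tail M \<gamma> (\<beta> * real n) X'"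
    and "0 < \<gamma>" "0 \<le> c" "0 < n" "0 < \<beta>"
  shows "expectation (\<lambda>\<omega>. exp (- c * \<bar>X \<omega>\<bar> ^ n)) = expectation (\<lambda>\<omega>. exp (- c * \<bar>X' \<omega>\<bar> ^ n))"
proof (cases "c = 0")
  case False
  then have c: "0 < c" using assms by simp
  have "\<gamma> powr (- (\<beta> * real n)) * (1 - expectation (\<lambda>\<omega>. exp (- c * \<bar>X \<omega>\<bar> ^ n)))
      = \<gamma> powr (- (\<beta> * real n)) * (1 - expectation (\<lambda>\<omega>. exp (- c * \<bar>X' \<omega>\<bar> ^ n)))"
    by (simp only: power_tail_laplace[OF assms(1,3) c assms(5,6)] power_tail_laplace[OF assms(2,3) c assms(5,6)])
  then show ?thesis using \<open>0 < \<gamma>\<close> by (simp del: mult_minus_left)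
qed simp

text \<open>The exponent is \<open>- t / Gamma (1 - \<beta>)\<close> times a quantity tending to
  \<open>c powr \<beta> * Gamma (1 - \<beta>)\<close>, so the Gamma factors cancel; the prefactor
  \<open>m\<close>, due to the step with index \<open>0\<close>, tends to one.\<close>

lemma (in prob_space) walk_factor_tendsto:
  assumes tail: "\<And>\<gamma>. 0 < \<gamma> \<Longrightarrow> power_tail M \<gamma> (\<beta> * real n) (X \<gamma>)"
    and pos: "0 \<le> c" "0 < n" "0 < \<beta>" "\<beta> < 1"
  defines "m \<equiv> (\<lambda>\<gamma>. expectation (\<lambda>\<omega>. exp (- c * \<bar>X \<gamma> \<omega>\<bar> ^ n)))"
  shows "((\<lambda>\<gamma>. m \<gamma> * exp (- (1 / Gamma (1 - \<beta>) * (t * \<gamma> powr (- (\<beta> * real n)))) * (1 - m \<gamma>)))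
           \<longlongrightarrow> exp (- t * c powr \<beta>)) (at_right 0)"
proof -
  let ?r = "\<lambda>\<gamma>. \<gamma> powr (- (\<beta> * real n))"
  have G: "0 < Gamma (1 - \<beta>)" using pos by (intro Gamma_real_pos) simp
  have lim: "((\<lambda>\<gamma>. ?r \<gamma> * (1 - m \<gamma>)) \<longlongrightarrow> c powr \<beta> * Gamma (1 - \<beta>)) (at_right 0)"
    unfolding m_def by (rule power_tail_laplace_tendsto[OF tail pos])
  have "filterlim ?r at_infinity (at_right 0)"
    using pos by (intro filterlim_at_top_imp_at_infinity filterlim_powr_neg_at_top_at_right_0) auto
  \<comment> \<open>\<open>1 - m\<close> is a convergent quantity divided by the diverging clock
    scale.\<close>
  from tendsto_divide_0[OF lim this]
  have "((\<lambda>\<gamma>. 1 - m \<gamma>) \<longlongrightarrow> 0) (at_right 0)"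
    by (rule Lim_transform_eventually)
       (use eventually_at_right_less[of 0] in eventually_elim, simp)
  from tendsto_diff[OF tendsto_const[of 1] this]
  have m: "(m \<longlongrightarrow> 1) (at_right 0)" by simp
  have "((\<lambda>\<gamma>. m \<gamma> * exp (- (t / Gamma (1 - \<beta>)) * (?r \<gamma> * (1 - m \<gamma>))))
      \<longlongrightarrow> 1 * exp (- (t / Gamma (1 - \<beta>)) * (c powr \<beta> * Gamma (1 - \<beta>)))) (at_right 0)"
    by (intro tendsto_intros m lim)
  then show ?thesis using G by (simp add: mult.assoc)
qed

text \<open>The powers \<open>2 * k\<close> and \<beta> compose to the exponent
  \<open>2 * k * \<beta>\<close>, the reciprocal of the one applied to \<open>w\<close>, so the
  weight re-enters linearly.\<close>

lemma power_powr_scaled: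
  fixes \<xi> w \<beta> :: real
  assumes "0 \<le> w" "0 < \<beta>" "0 < k"
  shows "(\<bar>\<xi> * w powr (1 / (2 * \<beta> * real k))\<bar> ^ (2 * k)) powr \<beta> = \<bar>\<xi>\<bar> powr (2 * real k * \<beta>) * w"
proof -
  have "(z ^ (2 * k)) powr \<beta> = z powr (2 * real k * \<beta>)" if "0 \<le> z" for z :: real
    using that assms by (cases "z = 0") (simp_all add: powr_realpow[symmetric] powr_powr)
  then have "(\<bar>\<xi> * w powr (1 / (2 * \<beta> * real k))\<bar> ^ (2 * k)) powr \<beta>
      = \<bar>\<xi> * w powr (1 / (2 * \<beta> * real k))\<bar> powr (2 * real k * \<beta>)"
    by simp
  also have "\<dots> = \<bar>\<xi>\<bar> powr (2 * real k * \<beta>) * w"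
    using assms by (simp add: abs_mult powr_mult powr_powr)
  finally show ?thesis .
qed

section \<open>Combining the two walks\<close>

theorem theorem3p6:
  fixes M :: "'a measure"
    and \<beta> \<theta> t :: real and k :: nat
    and u :: "real \<Rightarrow> real \<Rightarrow> real"
    and X Y :: "real \<Rightarrow> nat \<Rightarrow> 'a \<Rightarrow> real"
    and N N' :: "real \<Rightarrow> 'a \<Rightarrow> nat"
  assumes "prob_space M"
    and "0 < \<beta>" "\<beta> < 1" "- \<beta> < \<theta>" "\<theta> < \<beta>" "k \<ge> 1" "t > 0"
    and "pseudoprocess_density k u"
    and "\<And>\<gamma> j. \<gamma> > 0 \<Longrightarrow> power_tail M \<gamma> (2 * \<beta> * real k) (X \<gamma> j)"
    and "\<And>\<gamma> j. \<gamma> > 0 \<Longrightarrow> power_tail M \<gamma> (2 * \<beta> * real k) (Y \<gamma> j)"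
    and "poisson_process M (1 / Gamma (1 - \<beta>)) N"
    and "poisson_process M (1 / Gamma (1 - \<beta>)) N'"
    and "\<And>\<gamma>. \<gamma> > 0 \<Longrightarrow> mutually_independent M (X \<gamma>) (Y \<gamma>) N N'"
  shows "limit_in_law_0
    (\<lambda>\<gamma>. pseudo_ft M (\<lambda>x. u x 1)
       (walks_index N N' (t * \<gamma> powr (- (2 * \<beta> * real k))))
       (walks_sum
          ((sin (pi / 2 * (\<beta> - \<theta>)) / sin (pi * \<beta>)) powr (1 / (2 * \<beta> * real k)))
          ((sin (pi / 2 * (\<beta> + \<theta>)) / sin (pi * \<beta>)) powr (1 / (2 * \<beta> * real k)))
          (X \<gamma>) (Y \<gamma>) N N' (t * \<gamma> powr (- (2 * \<beta> * real k)))))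
    (\<lambda>\<xi>. complex_of_real
       (exp (- t * \<bar>\<xi>\<bar> powr (2 * real k * \<beta>) * (cos (pi / 2 * \<theta>) / cos (pi / 2 * \<beta>)))))"
proof -
  interpret prob_space M by fact
  define v w where "v = sin (pi / 2 * (\<beta> - \<theta>)) / sin (pi * \<beta>)"
    and "w = sin (pi / 2 * (\<beta> + \<theta>)) / sin (pi * \<beta>)"
  define a b where "a = v powr (1 / (2 * \<beta> * real k))" and "b = w powr (1 / (2 * \<beta> * real k))"
  define n where "n = 2 * k"
  have n: "0 < n" and idx: "2 * \<beta> * real k = \<beta> * real n" using \<open>k \<ge> 1\<close> by (auto simp: n_def)
  have sin_pos: "0 < sin (pi * x)" if "0 < x" "x < 1" for x
    using that by (intro sin_gt_zero) auto
  \<comment> \<open>Since \<open>\<bar>\<theta>\<bar> < \<beta> < 1\<close>, both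
    \<open>(\<beta> - \<theta>) / 2\<close> and \<open>(\<beta> + \<theta>) / 2\<close> lie strictly
    between \<open>0\<close> and \<open>1\<close>, so all three sines are positive.\<close>
  have vw0: "0 \<le> v" "0 \<le> w"
    using sin_pos[of \<beta>] sin_pos[of "(\<beta> - \<theta>) / 2"] sin_pos[of "(\<beta> + \<theta>) / 2"] assms(2-5)
    by (auto simp: v_def w_def intro!: divide_nonneg_pos less_imp_le)
  have vw: "v + w = cos (pi / 2 * \<theta>) / cos (pi / 2 * \<beta>)"
    unfolding v_def w_def using sin_pos[of \<beta>] assms(2-5) by (intro skew_weights_sum) auto
  have G: "0 < 1 / Gamma (1 - \<beta>)" using \<open>\<beta> < 1\<close> by (simp add: Gamma_real_pos)
  note tX = assms(9)[unfolded idx] and tY = assms(10)[unfolded idx]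
  show ?thesis
    unfolding limit_in_law_0_def v_def[symmetric] w_def[symmetric] a_def[symmetric] b_def[symmetric] vw[symmetric]
  proof
    fix \<xi>
    define f g where "f x = exp (- (\<bar>\<xi> * a\<bar> ^ n) * \<bar>x\<bar> ^ n)" and "g x = exp (- (\<bar>\<xi> * b\<bar> ^ n) * \<bar>x\<bar> ^ n)" for x :: real
    \<comment> \<open>Step \<open>0\<close> stands for all steps, whose factors have the same
      mean.\<close>
    define p q where "p \<gamma> = expectation (\<lambda>\<omega>. f (X \<gamma> 0 \<omega>))" and "q \<gamma> = expectation (\<lambda>\<omega>. g (Y \<gamma> 0 \<omega>))" for \<gamma>
    let ?s = "\<lambda>\<gamma>. t * \<gamma> powr (- (\<beta> * real n))"
    let ?F = "\<lambda>m \<gamma>. m \<gamma> * exp (- (1 / Gamma (1 - \<beta>) * ?s \<gamma>) * (1 - m \<gamma>)) :: real"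
    have "(?F p \<longlongrightarrow> exp (- t * (\<bar>\<xi> * a\<bar> ^ n) powr \<beta>)) (at_right 0)"
      unfolding p_def f_def by (rule walk_factor_tendsto) (use assms(2,3) n tX in auto)
    moreover have "(?F q \<longlongrightarrow> exp (- t * (\<bar>\<xi> * b\<bar> ^ n) powr \<beta>)) (at_right 0)"
      unfolding q_def g_def by (rule walk_factor_tendsto) (use assms(2,3) n tY in auto)
    ultimately have "((\<lambda>\<gamma>. complex_of_real (?F p \<gamma> * ?F q \<gamma>)) \<longlongrightarrow>
        complex_of_real (exp (- t * (\<bar>\<xi> * a\<bar> ^ n) powr \<beta>) * exp (- t * (\<bar>\<xi> * b\<bar> ^ n) powr \<beta>))) (at_right 0)"
      by (intro tendsto_of_real tendsto_mult)
    \<comment> \<open>Undoing the roots in \<open>a\<close> and \<open>b\<close> makes the two walks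
      contribute \<open>v\<close> and \<open>w\<close> to one exponent.\<close>
    moreover have "exp (- t * (\<bar>\<xi> * a\<bar> ^ n) powr \<beta>) * exp (- t * (\<bar>\<xi> * b\<bar> ^ n) powr \<beta>)
        = exp (- t * \<bar>\<xi>\<bar> powr (2 * real k * \<beta>) * (v + w))"
      unfolding a_def b_def n_def using assms(2) \<open>k \<ge> 1\<close> vw0
      by (simp only: power_powr_scaled exp_add[symmetric]) (simp add: algebra_simps power_powr_scaled)
    \<comment> \<open>The tails and independence are given for \<open>\<gamma> > 0\<close> only,
      which is all that a limit from the right sees.\<close>
    moreover have "\<forall>\<^sub>F \<gamma> in at_right 0. complex_of_real (?F p \<gamma> * ?F q \<gamma>)
        = pseudo_ft M (\<lambda>x. u x 1) (walks_index N N' (t * \<gamma> powr (- (2 * \<beta> * real k))))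
            (walks_sum a b (X \<gamma>) (Y \<gamma>) N N' (t * \<gamma> powr (- (2 * \<beta> * real k)))) \<xi>"
      using eventually_at_right_less[of 0]
    proof eventually_elim
      case (elim \<gamma>)
      have "expectation (\<lambda>\<omega>. (\<Prod>j\<le>N (?s \<gamma>) \<omega>. f (X \<gamma> j \<omega>)) * (\<Prod>j\<le>N' (?s \<gamma>) \<omega>. g (Y \<gamma> j \<omega>)))
          = ?F p \<gamma> * ?F q \<gamma>"
      proof (rule expectation_two_poisson_products[OF assms(13)[OF elim]])
        show "expectation (\<lambda>\<omega>. f (X \<gamma> j \<omega>)) = p \<gamma>" for j
          unfolding p_def f_def by (rule power_tail_laplace_eq[OF tX tX]) (use elim n assms(2) in auto)
        show "expectation (\<lambda>\<omega>. g (Y \<gamma> j \<omega>)) = q \<gamma>" for j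
          unfolding q_def g_def by (rule power_tail_laplace_eq[OF tY tY]) (use elim n assms(2) in auto)
        show "X \<gamma> j \<in> borel_measurable M" "Y \<gamma> j \<in> borel_measurable M" for j
          using tX[OF elim, of j] tY[OF elim, of j] by (auto simp: power_tail_def)
        show "f \<in> borel_measurable borel" "g \<in> borel_measurable borel"
          unfolding f_def g_def by measurable
      qed (use assms(7,11,12) G elim in \<open>auto simp: f_def g_def\<close>)
      then show ?case
        unfolding pseudo_ft_walks[OF assms(8)] idx f_def g_def n_def by simp
    qed
    ultimately show "((\<lambda>\<gamma>. pseudo_ft M (\<lambda>x. u x 1) (walks_index N N' (t * \<gamma> powr (- (2 * \<beta> * real k))))
        (walks_sum a b (X \<gamma>) (Y \<gamma>) N N' (t * \<gamma> powr (- (2 * \<beta> * real k)))) \<xi>)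
      \<longlongrightarrow> complex_of_real (exp (- t * \<bar>\<xi>\<bar> powr (2 * real k * \<beta>) * (v + w)))) (at_right 0)"
      by (simp only:) (rule Lim_transform_eventually)
  qed
qed

end
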